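(* Let $\Gamma$ be a countably infinite discrete group. The following statements are equivalent for a $\Gamma$-flow $X$ and a subgroup $\Delta\leq\Gamma$: (1) $X$ is disjoint from $(\Gamma/\Delta)^*$; (2) $X$ is $\Delta$-minimal.
   Context: A $\Gamma$-flow is a nonempty compact Hausdorff space $X$ equipped with a continuous action of $\Gamma$; a subflow is a nonempty closed $\Gamma$-invariant subset. For a subgroup $\Delta\leq\Gamma$, the set $\Gamma/\Delta$ of left cosets of $\Delta$ carries the discrete topology and the natural left action of $\Gamma$; $(\Gamma/\Delta)^*=(\Gamma/\Delta)\cup\{\infty\}$ is its one-point extension, in which the neighborhoods of $\infty$ are the sets containing $\infty$ with finite complement (so $\infty$ is isolated if $\Delta$ has finite index), and the action of $\Gamma$ is extended by fixing $\infty$. This is a $\Gamma$-flow. For $\Gamma$-flows $X,Y$, the product $X\times Y$ is a $\Gamma$-flow with the diagonal action; a joining of $X$ and $Y$ is a subflow $Z\subseteq X\times Y$ that projects onto $X$ and onto $Y$; $X$ and $Y$ are disjoint if their only joining is $X\times Y$. For $S\subseteq\Gamma$, a $\Gamma$-flow $X$ is $S$-minimal if $S\cdot x$ is dense in $X$ for every $x\in X$. *)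

theory Defs
  imports "HOL-Analysis.Analysis" "HOL-Algebra.Group_Action" "HOL-Algebra.Left_Coset"
begin

(* clashes with the topological closure_of *)
no_notation Congruence.eq_closure_of (\<open>closure'_of\<index>\<close>)

section \<open>Flows of a discrete group\<close>

text \<open>
  The acting group carries no topology of its own: it is discrete, which enters through the
  discrete topology on \<open>carrier G\<close> in the joint continuity of the action. As always with
  \<^const>\<open>group_action\<close>, the maps \<open>\<phi> g\<close> are extensional on the space.
\<close>

locale flow = group_action G "topspace X" \<phi>
  for G (structure) and X :: "'x topology" and \<phi> +
  assumes nonempty: "topspace X \<noteq> {}"
    and compact: "compact_space X"
    and Hausdorff: "Hausdorff_space X"
    and continuous:
      "continuous_map (prod_topology (discrete_topology (carrier G)) X) X (\<lambda>(g, x). \<phi> g x)"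

definition subflow ::
  "('g, 'm) monoid_scheme \<Rightarrow> 'x topology \<Rightarrow> ('g \<Rightarrow> 'x \<Rightarrow> 'x) \<Rightarrow> 'x set \<Rightarrow> bool" where
  "subflow G X \<phi> Z \<longleftrightarrow> Z \<noteq> {} \<and> closedin X Z \<and> (\<forall>g\<in>carrier G. \<phi> g ` Z \<subseteq> Z)"

definition diagonal_action ::
  "'x topology \<Rightarrow> ('g \<Rightarrow> 'x \<Rightarrow> 'x) \<Rightarrow> 'y topology \<Rightarrow> ('g \<Rightarrow> 'y \<Rightarrow> 'y) \<Rightarrow> 'g \<Rightarrow> 'x \<times> 'y \<Rightarrow> 'x \<times> 'y" where
  "diagonal_action X \<phi> Y \<psi> g = (\<lambda>(x, y) \<in> topspace X \<times> topspace Y. (\<phi> g x, \<psi> g y))"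

definition joining ::
  "('g, 'm) monoid_scheme \<Rightarrow> 'x topology \<Rightarrow> ('g \<Rightarrow> 'x \<Rightarrow> 'x) \<Rightarrow>
    'y topology \<Rightarrow> ('g \<Rightarrow> 'y \<Rightarrow> 'y) \<Rightarrow> ('x \<times> 'y) set \<Rightarrow> bool" where
  "joining G X \<phi> Y \<psi> Z \<longleftrightarrow>
     subflow G (prod_topology X Y) (diagonal_action X \<phi> Y \<psi>) Z \<and>
     fst ` Z = topspace X \<and> snd ` Z = topspace Y"

definition disjoint_flows ::
  "('g, 'm) monoid_scheme \<Rightarrow> 'x topology \<Rightarrow> ('g \<Rightarrow> 'x \<Rightarrow> 'x) \<Rightarrow>
    'y topology \<Rightarrow> ('g \<Rightarrow> 'y \<Rightarrow> 'y) \<Rightarrow> bool" where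
  "disjoint_flows G X \<phi> Y \<psi> \<longleftrightarrow> {Z. joining G X \<phi> Y \<psi> Z} = {topspace X \<times> topspace Y}"

text \<open>Here \<open>S\<close> is meant to be a subset of the acting group.\<close>

definition minimal_wrt :: "'g set \<Rightarrow> 'x topology \<Rightarrow> ('g \<Rightarrow> 'x \<Rightarrow> 'x) \<Rightarrow> bool" where
  "minimal_wrt S X \<phi> \<longleftrightarrow>
     (\<forall>x\<in>topspace X. X closure_of ((\<lambda>s. \<phi> s x) ` S) = topspace X)"


section \<open>The one-point extension of a coset space\<close>

text \<open>
  \<^const>\<open>None\<close> plays the role of the point at infinity. The neighbourhoods of \<^const>\<open>None\<close> are
  described in \<open>openin_coset_flow_None\<close> below; in particular \<^const>\<open>None\<close> is isolated if there
  are only finitely many cosets.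
\<close>

definition coset_flow :: "('g, 'm) monoid_scheme \<Rightarrow> 'g set \<Rightarrow> 'g set option topology" where
  "coset_flow G D = Alexandroff_compactification (discrete_topology (lcosets\<^bsub>G\<^esub> D))"

definition coset_action ::
  "('g, 'm) monoid_scheme \<Rightarrow> 'g set \<Rightarrow> 'g \<Rightarrow> 'g set option \<Rightarrow> 'g set option" where
  "coset_action G D g =
     (\<lambda>c \<in> insert None (Some ` (lcosets\<^bsub>G\<^esub> D)). map_option (\<lambda>C. g <#\<^bsub>G\<^esub> C) c)"


section \<open>The constructions are flows\<close>

lemma topspace_coset_flow [simp]:
  "topspace (coset_flow G D) = insert None (Some ` (lcosets\<^bsub>G\<^esub> D))"
  by (simp add: coset_flow_def)

lemma openin_coset_flow:
  "openin (coset_flow G D) U \<longleftrightarrow>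
    (\<exists>V. V \<subseteq> lcosets\<^bsub>G\<^esub> D \<and> U = Some ` V) \<or>
    (\<exists>C. C \<subseteq> lcosets\<^bsub>G\<^esub> D \<and> finite C \<and> U = insert None (Some ` (lcosets\<^bsub>G\<^esub> D - C)))"
  by (simp only: coset_flow_def openin_Alexandroff_compactification openin_discrete_topology
      compactin_discrete_topology closedin_discrete_topology topspace_discrete_topology) metis

lemma openin_coset_flow_None:
  assumes "None \<in> U"
  shows "openin (coset_flow G D) U \<longleftrightarrow>
    U \<subseteq> topspace (coset_flow G D) \<and> finite (topspace (coset_flow G D) - U)"
proof
  assume "openin (coset_flow G D) U"
  with assms obtain C where C: "finite C" "U = insert None (Some ` (lcosets\<^bsub>G\<^esub> D - C))"
    unfolding openin_coset_flow by blast
  have "topspace (coset_flow G D) - U \<subseteq> Some ` C" unfolding C(2) topspace_coset_flow by blast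
  then have "finite (topspace (coset_flow G D) - U)" using C(1) finite_surj by blast
  moreover have "U \<subseteq> topspace (coset_flow G D)" unfolding C(2) topspace_coset_flow by blast
  ultimately show "U \<subseteq> topspace (coset_flow G D) \<and> finite (topspace (coset_flow G D) - U)"
    by blast
next
  assume U: "U \<subseteq> topspace (coset_flow G D) \<and> finite (topspace (coset_flow G D) - U)"
  define C where "C = {c \<in> lcosets\<^bsub>G\<^esub> D. Some c \<notin> U}"
  have "Some ` C \<subseteq> topspace (coset_flow G D) - U" by (auto simp: C_def)
  then have "finite (Some ` C)" using U finite_subset by blast
  then have "finite C" by (rule finite_imageD) simp
  moreover have "U = insert None (Some ` (lcosets\<^bsub>G\<^esub> D - C))"
    using U assms unfolding C_def topspace_coset_flow by blast
  moreover have "C \<subseteq> lcosets\<^bsub>G\<^esub> D" unfolding C_def by blast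
  ultimately show "openin (coset_flow G D) U" unfolding openin_coset_flow by blast
qed

lemma continuous_map_discrete_prod:
  assumes "\<And>g. g \<in> A \<Longrightarrow> continuous_map X Y (f g)"
  shows "continuous_map (prod_topology (discrete_topology A) X) Y (\<lambda>(g, x). f g x)"
  unfolding continuous_map_def
proof (intro conjI allI impI)
  show "(\<lambda>(g, x). f g x) \<in> topspace (prod_topology (discrete_topology A) X) \<rightarrow> topspace Y"
    using assms by (auto simp: continuous_map_def)
next
  fix U assume U: "openin Y U"
  let ?V = "\<lambda>g. {x \<in> topspace X. f g x \<in> U}"
  have "{p \<in> topspace (prod_topology (discrete_topology A) X). (case p of (g, x) \<Rightarrow> f g x) \<in> U}
    = (\<Union>g\<in>A. {g} \<times> ?V g)" by auto
  moreover have "openin (prod_topology (discrete_topology A) X) (\<Union>g\<in>A. {g} \<times> ?V g)"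
  proof (intro openin_Union ballI, elim imageE, hypsubst)
    fix g assume "g \<in> A"
    then show "openin (prod_topology (discrete_topology A) X) ({g} \<times> ?V g)"
      using assms U by (auto simp: openin_prod_Times_iff continuous_map_def)
  qed
  ultimately show "openin (prod_topology (discrete_topology A) X)
      {p \<in> topspace (prod_topology (discrete_topology A) X). (case p of (g, x) \<Rightarrow> f g x) \<in> U}"
    by simp
qed

lemma group_actionI:
  assumes "group G"
    and ext: "\<And>g. g \<in> carrier G \<Longrightarrow> \<phi> g \<in> extensional E"
    and closed: "\<And>g x. g \<in> carrier G \<Longrightarrow> x \<in> E \<Longrightarrow> \<phi> g x \<in> E"
    and one: "\<And>x. x \<in> E \<Longrightarrow> \<phi> \<one>\<^bsub>G\<^esub> x = x"
    and mult: "\<And>g h x. g \<in> carrier G \<Longrightarrow> h \<in> carrier G \<Longrightarrow> x \<in> E \<Longrightarrow>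
      \<phi> (g \<otimes>\<^bsub>G\<^esub> h) x = \<phi> g (\<phi> h x)"
  shows "group_action G E \<phi>"
proof -
  interpret group G by fact
  have bij: "\<phi> g \<in> Bij E" if g: "g \<in> carrier G" for g
  proof -
    have "bij_betw (\<phi> g) E E"
      by (rule bij_betw_byWitness[where f' = "\<phi> (inv\<^bsub>G\<^esub> g)"])
        (use g closed one mult[symmetric] in auto)
    then show ?thesis using ext g by (simp add: Bij_def)
  qed
  show ?thesis
    unfolding group_action_def
  proof (intro group_hom.intro group_hom_axioms.intro group_BijGroup homI)
    fix g h assume gh: "g \<in> carrier G" "h \<in> carrier G"
    have "\<phi> (g \<otimes>\<^bsub>G\<^esub> h) = compose E (\<phi> g) (\<phi> h)"
      by (rule extensionalityI[where A = E])
        (use ext gh mult in \<open>auto simp: compose_def\<close>)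
    then show "\<phi> (g \<otimes>\<^bsub>G\<^esub> h) = \<phi> g \<otimes>\<^bsub>BijGroup E\<^esub> \<phi> h"
      using bij gh by (simp add: BijGroup_def)
  qed (use bij in \<open>auto simp: BijGroup_def is_group\<close>)
qed

lemma (in flow) continuous_map_action:
  assumes "g \<in> carrier G"
  shows "continuous_map X X (\<phi> g)"
proof -
  have "continuous_map X (prod_topology (discrete_topology (carrier G)) X) (\<lambda>x. (g, x))"
    using assms by (simp add: continuous_map_pairedI)
  from continuous_map_compose[OF this continuous] show ?thesis
    by (simp add: o_def)
qed

lemma flow_diagonal_action:
  assumes "flow G X \<phi>" "flow G Y \<psi>"
  shows "flow G (prod_topology X Y) (diagonal_action X \<phi> Y \<psi>)"
proof -
  interpret X: flow G X \<phi> by fact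
  interpret Y: flow G Y \<psi> by fact
  interpret G: group G using X.group_hom group_hom.axioms(1) by blast
  have one: "\<phi> \<one>\<^bsub>G\<^esub> x = x" if "x \<in> topspace X" for x
    using X.id_eq_one[THEN fun_cong, of x] that by simp
  have one': "\<psi> \<one>\<^bsub>G\<^esub> y = y" if "y \<in> topspace Y" for y
    using Y.id_eq_one[THEN fun_cong, of y] that by simp
  have closed: "\<phi> g x \<in> topspace X" if "g \<in> carrier G" "x \<in> topspace X" for g x
    using X.element_image that by blast
  have closed': "\<psi> g y \<in> topspace Y" if "g \<in> carrier G" "y \<in> topspace Y" for g y
    using Y.element_image that by blast
  have "group_action G (topspace (prod_topology X Y)) (diagonal_action X \<phi> Y \<psi>)"
  proof (rule group_actionI)
    show "group G" by (rule G.is_group)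
  qed (auto simp: diagonal_action_def closed closed' one one' X.composition_rule Y.composition_rule)
  moreover have "continuous_map (prod_topology X Y) (prod_topology X Y) (diagonal_action X \<phi> Y \<psi> g)"
    if g: "g \<in> carrier G" for g
  proof (rule continuous_map_eq)
    show "continuous_map (prod_topology X Y) (prod_topology X Y) (\<lambda>(x, y). (\<phi> g x, \<psi> g y))"
      using X.continuous_map_action[OF g] Y.continuous_map_action[OF g]
      by (simp add: continuous_map_prod_top)
  qed (auto simp: diagonal_action_def)
  ultimately show ?thesis
    using X.nonempty Y.nonempty X.compact Y.compact X.Hausdorff Y.Hausdorff
    by (intro flow.intro flow_axioms.intro continuous_map_discrete_prod)
      (auto simp: compact_space_prod_topology Hausdorff_space_prod_topology)
qed

lemma flow_coset_flow:
  assumes "group G" "subgroup D G"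
  shows "flow G (coset_flow G D) (coset_action G D)"
proof -
  interpret G: group G by fact
  let ?T = "coset_flow G D" and ?a = "coset_action G D"
  have sub: "C \<subseteq> carrier G" if "C \<in> lcosets\<^bsub>G\<^esub> D" for C
    using that assms G.lcosets_subset_PowG by blast
  have closed: "g <#\<^bsub>G\<^esub> C \<in> lcosets\<^bsub>G\<^esub> D" if "g \<in> carrier G" "C \<in> lcosets\<^bsub>G\<^esub> D" for g C
    using that subgroup.subset[OF assms(2)] by (fastforce simp: LCOSETS_def G.lcos_m_assoc)
  have act: "group_action G (topspace ?T) ?a"
  proof (rule group_actionI)
    show "group G" by fact
  qed (auto simp: coset_action_def closed sub G.lcos_m_assoc G.lcos_mult_one)
  interpret A: group_action G "topspace ?T" ?a by (rule act)
  have fixN: "?a g None = None" for g by (simp add: coset_action_def)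
  have "continuous_map ?T ?T (?a g)" if g: "g \<in> carrier G" for g
    unfolding continuous_map_def
  proof (intro conjI allI impI)
    show "?a g \<in> topspace ?T \<rightarrow> topspace ?T" using g A.element_image by blast
  next
    fix U assume U: "openin ?T U"
    let ?P = "{x \<in> topspace ?T. ?a g x \<in> U}"
    show "openin ?T ?P"
    proof (cases "None \<in> U")
      case True
      have "?a g ` (topspace ?T - ?P) \<subseteq> topspace ?T - U"
        using g A.element_image by blast
      moreover have "finite (topspace ?T - U)"
        using U True openin_coset_flow_None by blast
      ultimately have "finite (?a g ` (topspace ?T - ?P))" using finite_subset by blast
      moreover have "inj_on (?a g) (topspace ?T - ?P)"
        using A.inj_prop[OF g] inj_on_subset by blast
      ultimately have "finite (topspace ?T - ?P)" using finite_imageD by blast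
      moreover have "None \<in> ?P" using True fixN by simp
      ultimately show ?thesis by (subst openin_coset_flow_None) auto
    next
      case False
      then have "None \<notin> ?P" by (simp add: fixN)
      then obtain V where "V \<subseteq> lcosets\<^bsub>G\<^esub> D" "?P = Some ` V"
        by (metis (no_types, lifting) mem_Collect_eq subsetI subset_imageE subset_insert
            topspace_coset_flow)
      then show ?thesis unfolding openin_coset_flow by blast
    qed
  qed
  moreover have "compact_space ?T" "Hausdorff_space ?T"
    by (simp_all add: coset_flow_def Hausdorff_space_Alexandroff_compactification
        locally_compact_space_discrete_topology)
  ultimately show ?thesis
    using act by (intro flow.intro flow_axioms.intro continuous_map_discrete_prod) auto
qed

end

theory Submission
  imports Defs
begin

text \<open>
  For a subgroup \<open>D\<close>, being \<open>D\<close>-minimal means having no proper nonempty closed \<open>D\<close>-invariant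
  subset, and such subsets correspond to joinings of \<open>X\<close> with the one-point extension of \<open>G / D\<close>
  through fibres: a subflow of the product is determined over the orbit \<open>G / D\<close> by its fibre over
  the base point \<open>D\<close>, and that fibre is invariant under the stabilizer of the base point, which
  is \<open>D\<close>.

  If \<open>X\<close> is \<open>D\<close>-minimal and \<open>Z\<close> is a joining, then the fibres of \<open>Z\<close> over the two points
  \<open>D\<close> and \<open>\<infinity>\<close>, both fixed by \<open>D\<close>, are nonempty, closed and \<open>D\<close>-invariant, hence all of \<open>X\<close>
  (\<open>fibre_eq_topspace\<close>). Translating the fibre over \<open>D\<close> fills the fibres over the other cosets,
  so \<open>Z\<close> is the whole product. Treating \<open>\<infinity>\<close> in the same way as \<open>D\<close>, instead of as a limit of
  cosets, makes the argument independent of the index of \<open>D\<close>.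

  Conversely, a closed \<open>D\<close>-invariant set \<open>Y\<close> with \<open>{} \<noteq> Y \<noteq> X\<close> gives the proper joining whose
  fibre over \<open>g D\<close> is \<open>g Y\<close> and whose fibre over \<open>\<infinity>\<close> is \<open>X\<close> (\<open>joining_induced_joining\<close>). It is closed
  because cosets are isolated points and no condition is imposed over \<open>\<infinity>\<close>.
\<close>

section \<open>Minimality with respect to a subgroup\<close>

context flow
begin

lemma action_closed: "g \<in> carrier G \<Longrightarrow> x \<in> topspace X \<Longrightarrow> \<phi> g x \<in> topspace X"
  using element_image by blast

lemma action_one: "x \<in> topspace X \<Longrightarrow> \<phi> \<one> x = x"
  using id_eq_one[THEN fun_cong, of x] by simp

lemma action_inv_cancel:
  assumes "g \<in> carrier G" "x \<in> topspace X"
  shows "\<phi> g (\<phi> (inv g) x) = x"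
proof -
  interpret G: group G using group_hom group_hom.axioms(1) by blast
  show ?thesis
    using assms by (simp add: composition_rule[symmetric] action_one)
qed

text \<open>
  Orbit closures of a subgroup are invariant because each group element acts continuously, so
  density of all orbits amounts to the absence of proper closed invariant subsets.
\<close>

lemma minimal_wrt_subgroup_iff:
  assumes D: "subgroup D G"
  shows "minimal_wrt D X \<phi> \<longleftrightarrow>
    (\<forall>Y. closedin X Y \<and> Y \<noteq> {} \<and> (\<forall>d\<in>D. \<phi> d ` Y \<subseteq> Y) \<longrightarrow> Y = topspace X)"
proof (intro iffI allI impI)
  fix Y assume min: "minimal_wrt D X \<phi>"
    and Y: "closedin X Y \<and> Y \<noteq> {} \<and> (\<forall>d\<in>D. \<phi> d ` Y \<subseteq> Y)"
  then obtain y where y: "y \<in> Y" by blast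
  have YX: "Y \<subseteq> topspace X" using Y closedin_subset by blast
  have "(\<lambda>d. \<phi> d y) ` D \<subseteq> Y" using Y y by blast
  then have "X closure_of ((\<lambda>d. \<phi> d y) ` D) \<subseteq> Y"
    using Y by (simp add: closure_of_minimal)
  moreover have "X closure_of ((\<lambda>d. \<phi> d y) ` D) = topspace X"
    using min y YX by (auto simp: minimal_wrt_def)
  ultimately show "Y = topspace X" using YX by blast
next
  assume *: "\<forall>Y. closedin X Y \<and> Y \<noteq> {} \<and> (\<forall>d\<in>D. \<phi> d ` Y \<subseteq> Y) \<longrightarrow> Y = topspace X"
  show "minimal_wrt D X \<phi>"
    unfolding minimal_wrt_def
  proof
    fix x assume x: "x \<in> topspace X"
    let ?O = "(\<lambda>d. \<phi> d x) ` D"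
    have DG: "d \<in> carrier G" if "d \<in> D" for d using subgroup.mem_carrier[OF D that] .
    have O_sub: "?O \<subseteq> topspace X" using x DG action_closed by blast
    have "\<phi> d ` (X closure_of ?O) \<subseteq> X closure_of ?O" if d: "d \<in> D" for d
    proof -
      have "\<phi> d ` ?O \<subseteq> ?O"
        using d x DG subgroup.m_closed[OF D d]
        by (auto simp: composition_rule[symmetric])
      then show ?thesis
        using continuous_map_image_closure_subset[OF continuous_map_action[OF DG[OF d]], of ?O]
          closure_of_mono by blast
    qed
    moreover have "X closure_of ?O \<noteq> {}"
      using closure_of_subset[OF O_sub] subgroup.one_closed[OF D] by blast
    ultimately show "X closure_of ?O = topspace X"
      using *[rule_format, of "X closure_of ?O"] by simp
  qed
qed

end

section \<open>Fibres of a joining\<close>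

lemma closedin_fibre:
  assumes "closedin (prod_topology X Y) Z" "y \<in> topspace Y"
  shows "closedin X {x \<in> topspace X. (x, y) \<in> Z}"
proof -
  have "continuous_map X (prod_topology X Y) (\<lambda>x. (x, y))"
    using assms(2) by (simp add: continuous_map_pairedI)
  then show ?thesis using assms(1) by (rule closedin_continuous_map_preimage)
qed

text \<open>
  The fibre of an invariant set over a point is invariant under the stabilizer of that point,
  and the projection onto \<open>Y\<close> makes it nonempty, so minimality forces it to be everything.
\<close>

lemma fibre_eq_topspace:
  assumes "flow G X \<phi>" "subgroup D G" and min: "minimal_wrt D X \<phi>"
    and Z: "joining G X \<phi> Y \<psi> Z"
    and y: "y \<in> topspace Y" and fixed: "\<And>d. d \<in> D \<Longrightarrow> \<psi> d y = y"
    and x: "x \<in> topspace X"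
  shows "(x, y) \<in> Z"
proof -
  interpret flow G X \<phi> by fact
  let ?F = "{x \<in> topspace X. (x, y) \<in> Z}"
  have clZ: "closedin (prod_topology X Y) Z" and snd: "snd ` Z = topspace Y"
    and inv: "\<And>g. g \<in> carrier G \<Longrightarrow> diagonal_action X \<phi> Y \<psi> g ` Z \<subseteq> Z"
    using Z by (auto simp: joining_def subflow_def)
  have "closedin X ?F" using closedin_fibre[OF clZ y] .
  moreover have "?F \<noteq> {}"
  proof -
    from y snd obtain p where p: "p \<in> Z" "snd p = y" by (metis imageE)
    have "p \<in> topspace (prod_topology X Y)" using p(1) closedin_subset[OF clZ] by blast
    with p have "fst p \<in> ?F" by auto
    then show ?thesis by blast
  qed
  moreover have "\<phi> d ` ?F \<subseteq> ?F" if d: "d \<in> D" for d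
  proof
    fix w assume "w \<in> \<phi> d ` ?F"
    then obtain z where z: "z \<in> topspace X" "(z, y) \<in> Z" and w: "w = \<phi> d z" by blast
    have dG: "d \<in> carrier G" using subgroup.mem_carrier[OF assms(2) d] .
    have "diagonal_action X \<phi> Y \<psi> d (z, y) \<in> Z" using inv[OF dG] z by blast
    then show "w \<in> ?F"
      using z y w fixed[OF d] action_closed[OF dG] by (simp add: diagonal_action_def)
  qed
  ultimately have "?F = topspace X"
    using min minimal_wrt_subgroup_iff[OF assms(2)] by blast
  with x show ?thesis by blast
qed

lemma joining_topspace_Times:
  assumes "flow G X \<phi>" "flow G Y \<psi>"
  shows "joining G X \<phi> Y \<psi> (topspace X \<times> topspace Y)"
proof -
  interpret X: flow G X \<phi> by fact
  interpret Y: flow G Y \<psi> by fact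
  have "closedin (prod_topology X Y) (topspace X \<times> topspace Y)"
    using closedin_topspace[of "prod_topology X Y"] by simp
  then show ?thesis
    using X.nonempty Y.nonempty X.action_closed Y.action_closed
    by (auto simp: joining_def subflow_def diagonal_action_def)
qed

lemma coset_action_None: "coset_action G D g None = None"
  by (simp add: coset_action_def)

lemma coset_action_Some:
  "C \<in> lcosets\<^bsub>G\<^esub> D \<Longrightarrow> coset_action G D g (Some C) = Some (g <#\<^bsub>G\<^esub> C)"
  by (simp add: coset_action_def)

lemma subgroup_in_lcosets:
  assumes "group G" "subgroup D G"
  shows "D \<in> lcosets\<^bsub>G\<^esub> D"
proof -
  interpret group G by fact
  have "\<one>\<^bsub>G\<^esub> <#\<^bsub>G\<^esub> D = D" using assms subgroup.subset lcos_mult_one by blast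
  then show ?thesis by (auto simp: LCOSETS_def)
qed

lemma joining_coset_flow_eq_Times:
  assumes "group G" "flow G X \<phi>" "subgroup D G" and min: "minimal_wrt D X \<phi>"
    and Z: "joining G X \<phi> (coset_flow G D) (coset_action G D) Z"
  shows "Z = topspace X \<times> topspace (coset_flow G D)"
proof
  interpret group G by fact
  interpret flow G X \<phi> by fact
  show "Z \<subseteq> topspace X \<times> topspace (coset_flow G D)"
    using Z closedin_subset by (fastforce simp: joining_def subflow_def)
  have D: "D \<in> lcosets\<^bsub>G\<^esub> D" using assms subgroup_in_lcosets by blast
  have over_None: "(x, None) \<in> Z" if "x \<in> topspace X" for x
    by (rule fibre_eq_topspace[OF assms(2-3) min Z])
      (use that in \<open>simp_all add: coset_action_None\<close>)
  have over_D: "(x, Some D) \<in> Z" if "x \<in> topspace X" for x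
  proof (rule fibre_eq_topspace[OF assms(2-3) min Z])
    fix d assume d: "d \<in> D"
    then have "d <#\<^bsub>G\<^esub> D = D"
      using assms(3) subgroup.mem_carrier[OF assms(3)] by (simp add: coset_join3)
    then show "coset_action G D d (Some D) = Some D"
      using D by (simp add: coset_action_Some)
  qed (use that D in simp_all)
  have over_coset: "(x, Some (g <#\<^bsub>G\<^esub> D)) \<in> Z" if x: "x \<in> topspace X" and g: "g \<in> carrier G" for x g
  proof -
    have mem: "\<phi> (inv\<^bsub>G\<^esub> g) x \<in> topspace X" using x g action_closed by simp
    have "diagonal_action X \<phi> (coset_flow G D) (coset_action G D) g (\<phi> (inv\<^bsub>G\<^esub> g) x, Some D) \<in> Z"
      using Z g over_D[OF mem] by (auto simp: joining_def subflow_def)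
    then show ?thesis
      using mem D x g by (simp add: diagonal_action_def coset_action_Some action_inv_cancel)
  qed
  show "topspace X \<times> topspace (coset_flow G D) \<subseteq> Z"
    using over_None over_coset by (auto simp: LCOSETS_def)
qed

section \<open>The joining induced by an invariant set\<close>

text \<open>
  For a \<open>D\<close>-invariant set \<open>Y\<close> the fibre over a coset \<open>C = g D\<close> is \<open>g Y\<close>. Writing it as an
  intersection over all representatives of \<open>C\<close>, rather than by choosing one, makes it visibly
  well defined and closed.
\<close>

definition induced_joining ::
  "('g, 'm) monoid_scheme \<Rightarrow> 'x topology \<Rightarrow> ('g \<Rightarrow> 'x \<Rightarrow> 'x) \<Rightarrow> 'g set \<Rightarrow> 'x set \<Rightarrow>
    ('x \<times> 'g set option) set" where
  "induced_joining G X \<phi> D Y =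
     topspace X \<times> {None} \<union>
     {(x, Some C) | x C. x \<in> topspace X \<and> C \<in> lcosets\<^bsub>G\<^esub> D \<and> (\<forall>g\<in>C. \<phi> (inv\<^bsub>G\<^esub> g) x \<in> Y)}"

text \<open>
  A point outside violates the condition at some representative \<open>g\<close> of its coset; by continuity
  of \<open>g\<close> inverse so do all nearby points over the same coset, which is isolated.
\<close>

lemma closedin_induced_joining:
  assumes "group G" "flow G X \<phi>" "subgroup D G" "closedin X Y"
  shows "closedin (prod_topology X (coset_flow G D)) (induced_joining G X \<phi> D Y)"
proof -
  interpret group G by fact
  interpret flow G X \<phi> by fact
  let ?P = "prod_topology X (coset_flow G D)"
  let ?U = "\<lambda>g. {x \<in> topspace X. \<phi> (inv\<^bsub>G\<^esub> g) x \<in> topspace X - Y}"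
  have CG: "g \<in> carrier G" if "C \<in> lcosets\<^bsub>G\<^esub> D" "g \<in> C" for C g
    using that assms(3) lcosets_subset_PowG by blast
  have "openin ?P (?U g \<times> {Some C})" if "C \<in> lcosets\<^bsub>G\<^esub> D" "g \<in> C" for C g
  proof -
    have "openin X (?U g)"
      using CG[OF that] assms(4)
      by (intro openin_continuous_map_preimage[OF continuous_map_action]) auto
    moreover have "openin (coset_flow G D) {Some C}"
      unfolding openin_coset_flow using that by (intro disjI1 exI[of _ "{C}"]) auto
    ultimately show ?thesis by (simp add: openin_prod_Times_iff)
  qed
  then have "openin ?P (\<Union>C\<in>lcosets\<^bsub>G\<^esub> D. \<Union>g\<in>C. ?U g \<times> {Some C})" by blast
  moreover have "topspace ?P - induced_joining G X \<phi> D Y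
      = (\<Union>C\<in>lcosets\<^bsub>G\<^esub> D. \<Union>g\<in>C. ?U g \<times> {Some C})"
  proof -
    have "\<phi> (inv\<^bsub>G\<^esub> g) x \<in> topspace X" if "C \<in> lcosets\<^bsub>G\<^esub> D" "g \<in> C" "x \<in> topspace X" for C g x
      using CG[OF that(1,2)] that(3) action_closed by simp
    then show ?thesis by (auto simp: induced_joining_def)
  qed
  moreover have "induced_joining G X \<phi> D Y \<subseteq> topspace ?P"
    by (auto simp: induced_joining_def)
  ultimately show ?thesis by (simp add: closedin_def)
qed

lemma subflow_induced_joining:
  assumes "group G" "flow G X \<phi>" "subgroup D G" "closedin X Y"
  shows "subflow G (prod_topology X (coset_flow G D))
    (diagonal_action X \<phi> (coset_flow G D) (coset_action G D)) (induced_joining G X \<phi> D Y)"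
proof -
  interpret group G by fact
  interpret flow G X \<phi> by fact
  interpret C: flow G "coset_flow G D" "coset_action G D"
    using assms flow_coset_flow by blast
  let ?Z = "induced_joining G X \<phi> D Y"
  have "diagonal_action X \<phi> (coset_flow G D) (coset_action G D) h (x, c) \<in> ?Z"
    if h: "h \<in> carrier G" and xc: "(x, c) \<in> ?Z" for h x c
  proof (cases c)
    case None
    then show ?thesis
      using xc h action_closed
      by (auto simp: induced_joining_def diagonal_action_def coset_action_None)
  next
    case (Some C)
    with xc have x: "x \<in> topspace X" and C: "C \<in> lcosets\<^bsub>G\<^esub> D"
      and Y: "\<And>g. g \<in> C \<Longrightarrow> \<phi> (inv\<^bsub>G\<^esub> g) x \<in> Y"
      by (auto simp: induced_joining_def)
    have sub: "C \<subseteq> carrier G" using C assms(3) lcosets_subset_PowG by blast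
    have "coset_action G D h (Some C) \<in> topspace (coset_flow G D)"
      using C h by (intro C.action_closed) auto
    then have hC: "h <#\<^bsub>G\<^esub> C \<in> lcosets\<^bsub>G\<^esub> D" using C by (auto simp: coset_action_Some)
    have "\<phi> (inv\<^bsub>G\<^esub> k) (\<phi> h x) \<in> Y" if k: "k \<in> h <#\<^bsub>G\<^esub> C" for k
    proof -
      from k obtain g where g: "g \<in> C" "k = h \<otimes>\<^bsub>G\<^esub> g" by (auto simp: l_coset_def)
      then have gG: "g \<in> carrier G" using sub by blast
      have "inv\<^bsub>G\<^esub> k \<otimes>\<^bsub>G\<^esub> h = inv\<^bsub>G\<^esub> g"
        using g(2) gG h by (simp add: inv_mult_group m_assoc)
      then have "\<phi> (inv\<^bsub>G\<^esub> k) (\<phi> h x) = \<phi> (inv\<^bsub>G\<^esub> g) x"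
        using g(2) gG h x composition_rule[of x "inv\<^bsub>G\<^esub> k" h] by simp
      then show ?thesis using Y g by simp
    qed
    then show ?thesis
      using Some x C h hC action_closed
      by (auto simp: induced_joining_def diagonal_action_def coset_action_Some)
  qed
  moreover have "?Z \<noteq> {}" using nonempty by (auto simp: induced_joining_def)
  ultimately show ?thesis
    using closedin_induced_joining[OF assms] by (auto simp: subflow_def)
qed

text \<open>
  The fibre over \<open>\<infinity>\<close> alone already projects onto \<open>X\<close>; invariance of \<open>Y\<close> puts \<open>g Y\<close> into the
  fibre over \<open>g D\<close>, so no coset is missed.
\<close>

lemma joining_induced_joining:
  assumes "group G" "flow G X \<phi>" "subgroup D G" "closedin X Y"
    and "Y \<noteq> {}" and inv: "\<And>d. d \<in> D \<Longrightarrow> \<phi> d ` Y \<subseteq> Y"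
  shows "joining G X \<phi> (coset_flow G D) (coset_action G D) (induced_joining G X \<phi> D Y)"
proof -
  interpret group G by fact
  interpret flow G X \<phi> by fact
  let ?Z = "induced_joining G X \<phi> D Y"
  have "fst ` ?Z = topspace X" by (force simp: induced_joining_def)
  moreover have "snd ` ?Z = topspace (coset_flow G D)"
  proof
    show "snd ` ?Z \<subseteq> topspace (coset_flow G D)" by (auto simp: induced_joining_def)
    obtain y where y: "y \<in> Y" using \<open>Y \<noteq> {}\<close> by blast
    then have yX: "y \<in> topspace X" using assms(4) closedin_subset by blast
    have "(\<phi> g y, Some (g <#\<^bsub>G\<^esub> D)) \<in> ?Z" if g: "g \<in> carrier G" for g
    proof -
      have "\<phi> (inv\<^bsub>G\<^esub> k) (\<phi> g y) \<in> Y" if k: "k \<in> g <#\<^bsub>G\<^esub> D" for k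
      proof -
        from k obtain d where d: "d \<in> D" "k = g \<otimes>\<^bsub>G\<^esub> d" by (auto simp: l_coset_def)
        have dG: "d \<in> carrier G" using subgroup.mem_carrier[OF assms(3) d(1)] .
        have "inv\<^bsub>G\<^esub> k \<otimes>\<^bsub>G\<^esub> g = inv\<^bsub>G\<^esub> d"
          using d(2) dG g by (simp add: inv_mult_group m_assoc)
        then have "\<phi> (inv\<^bsub>G\<^esub> k) (\<phi> g y) = \<phi> (inv\<^bsub>G\<^esub> d) y"
          using d(2) dG g yX composition_rule[of y "inv\<^bsub>G\<^esub> k" g] by simp
        then show ?thesis
          using inv[OF subgroup.m_inv_closed[OF assms(3) d(1)]] y by auto
      qed
      then show ?thesis
        using g yX action_closed by (auto simp: induced_joining_def LCOSETS_def)
    qed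
    moreover have "(y, None) \<in> ?Z" using yX by (simp add: induced_joining_def)
    ultimately show "topspace (coset_flow G D) \<subseteq> snd ` ?Z"
      by (force simp: LCOSETS_def)
  qed
  ultimately show ?thesis
    using subflow_induced_joining[OF assms(1-4)] by (simp add: joining_def)
qed

theorem proposition1p16:
  fixes G :: "('g, 'm) monoid_scheme" and X :: "'x topology"
    and \<phi> :: "'g \<Rightarrow> 'x \<Rightarrow> 'x" and D :: "'g set"
  assumes "group G" and "countable (carrier G)" and "infinite (carrier G)"
    and "flow G X \<phi>" and "subgroup D G"
  shows "disjoint_flows G X \<phi> (coset_flow G D) (coset_action G D) \<longleftrightarrow> minimal_wrt D X \<phi>"
proof
  interpret flow G X \<phi> by fact
  assume disj: "disjoint_flows G X \<phi> (coset_flow G D) (coset_action G D)"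
  show "minimal_wrt D X \<phi>"
    unfolding minimal_wrt_subgroup_iff[OF assms(5)]
  proof (intro allI impI)
    fix Y assume Y: "closedin X Y \<and> Y \<noteq> {} \<and> (\<forall>d\<in>D. \<phi> d ` Y \<subseteq> Y)"
    have "induced_joining G X \<phi> D Y = topspace X \<times> topspace (coset_flow G D)"
      using joining_induced_joining[OF assms(1,4,5)] Y disj
      unfolding disjoint_flows_def by blast
    then have all: "(x, Some D) \<in> induced_joining G X \<phi> D Y" if "x \<in> topspace X" for x
      using that subgroup_in_lcosets[OF assms(1,5)] by simp
    \<comment> \<open>Evaluate the condition over the coset \<open>D\<close> at its representative \<open>\<one>\<close>.\<close>
    have "x \<in> Y" if "x \<in> topspace X" for x
    proof -
      have "\<phi> (inv\<^bsub>G\<^esub> \<one>\<^bsub>G\<^esub>) x \<in> Y"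
        using all[OF that] subgroup.one_closed[OF assms(5)] by (auto simp: induced_joining_def)
      then show ?thesis
        using that group.is_monoid[OF assms(1)] by (simp add: monoid.inv_one action_one)
    qed
    then show "Y = topspace X" using Y closedin_subset by blast
  qed
next
  assume "minimal_wrt D X \<phi>"
  then show "disjoint_flows G X \<phi> (coset_flow G D) (coset_action G D)"
    using joining_coset_flow_eq_Times[OF assms(1,4,5)]
      joining_topspace_Times[OF assms(4) flow_coset_flow[OF assms(1,5)]]
    unfolding disjoint_flows_def by blast
qed

end
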